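(* Let $G$ be a locally compact second countable group acting measurably and preserving the probability measure $\nu$ on a standard Borel space $(X,\mathcal B,\nu)$, let $1\le p\le\infty$, and suppose $\{G_t\}_{t>0}$ is a quasi-uniform family whose Haar-uniform averages $\beta_t$ satisfy the pointwise ergodic theorem in $L^p(\nu)$. Then for every $f\in L^p(\nu)$ there exists a $G$-invariant measurable set $\Omega(f)$ of full measure such that for every $x\in\Omega(f)$, $\lim_{t\to\infty}\pi(\beta_t)f(x)=\int_Xf\,d\nu$. In particular this holds for admissible one-parameter families and admissible sequences on $S$-algebraic groups (satisfying the pointwise ergodic theorem in $L^p(\nu)$).
   Context: $m_G$ is a left Haar measure, $\beta_t=m_G|_{G_t}/m_G(G_t)$, $\pi(\beta_t)f(x)=\frac1{m_G(G_t)}\int_{G_t}f(g^{-1}x)dm_G(g)$. An increasing family of bounded Borel sets $\{G_t\}_{t>0}$ of positive measure is quasi-uniform if (i) for every $\varepsilon>0$ there is a neighborhood $\mathcal O$ of $e$ with $\mathcal O G_t\subset G_{t+\varepsilon}$ for all sufficiently large $t$, and (ii) for every $\delta>0$ there is $\varepsilon>0$ with $m_G(G_{t+\varepsilon})\le(1+\delta)m_G(G_t)$ for all sufficiently large $t$. $\beta_t$ satisfies the pointwise ergodic theorem in $L^p(\nu)$ if $\pi(\beta_t)f(x)\to\int f\,d\nu$ for $\nu$-a.e. $x$ for every $f\in L^p(\nu)$. $S$-algebraic groups and admissibility: $G$ a finite product of groups $\mathbf G_i(F_i)$ ($F_i$ locally compact non-discrete fields, $\mathbf G_i$ algebraically connected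 semisimple of positive $F_i$-rank, no $F_i$-anisotropic factors, $G_i^+$ of finite index), $\mathcal O_\varepsilon=\mathcal U_\varepsilon\times K_0$ ($\mathcal U_\varepsilon$ Riemannian balls of the Archimedean part, $K_0$ compact open in the non-Archimedean part); a one-parameter family is admissible if it is coarsely admissible (for every bounded $B$, $BG_tB\subset G_{t+c_B}$ for large $t$; for every $c$, $m_G(G_{t+c})\le d\,m_G(G_t)$ for large $t$) and for some $c,t_0,\varepsilon_0$: $\mathcal O_\varepsilon G_t\mathcal O_\varepsilon\subset G_{t+c\varepsilon}$, $m_G(G_{t+\varepsilon})\le(1+c\varepsilon)m_G(G_t)$ for $t\ge t_0$, $\varepsilon\le\varepsilon_0$; an admissible sequence ($t\in\mathbb N$, totally disconnected $G$) is coarsely admissible with $K_0G_tK_0=G_t$ for large $t$. *)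

theory Defs
  imports "HOL-Analysis.Analysis" "HOL-Probability.Probability"
begin

text \<open>The group G is written additively (class group_add is NOT assumed commutative).
  Left Haar measure: a Borel measure, left-invariant, finite on compact sets and
  positive on nonempty open sets.\<close>
definition left_haar_measure :: "('g::{topological_group_add}) measure \<Rightarrow> bool" where
  "left_haar_measure m \<longleftrightarrow>
     sets m = sets borel \<and>
     (\<forall>g A. A \<in> sets borel \<longrightarrow> emeasure m ((\<lambda>y. g + y) ` A) = emeasure m A) \<and>
     (\<forall>K. compact K \<longrightarrow> emeasure m K < \<infinity>) \<and>
     (\<forall>U. open U \<and> U \<noteq> {} \<longrightarrow> emeasure m U > 0)"

definition mp_action :: "('g::topological_group_add \<Rightarrow> 'x \<Rightarrow> 'x) \<Rightarrow> 'x measure \<Rightarrow> bool" where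
  "mp_action act M \<longleftrightarrow>
     (\<forall>x \<in> space M. act 0 x = x) \<and>
     (\<forall>g h. \<forall>x \<in> space M. act (g + h) x = act g (act h x)) \<and>
     (\<lambda>(g, x). act g x) \<in> measurable (borel \<Otimes>\<^sub>M M) M \<and>
     (\<forall>g. distr M M (act g) = M)"

definition memLp :: "'x measure \<Rightarrow> ennreal \<Rightarrow> ('x \<Rightarrow> real) \<Rightarrow> bool" where
  "memLp M p f \<longleftrightarrow> f \<in> borel_measurable M \<and>
     (if p = \<infinity> then (\<exists>C. AE x in M. \<bar>f x\<bar> \<le> C)
      else (\<integral>\<^sup>+ x. ennreal (\<bar>f x\<bar> powr enn2real p) \<partial>M) < \<infinity>)"

definition haar_avg :: "'g::topological_group_add measure \<Rightarrow> 'g set \<Rightarrow> ('g \<Rightarrow> 'x \<Rightarrow> 'x)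
    \<Rightarrow> ('x \<Rightarrow> real) \<Rightarrow> 'x \<Rightarrow> real" where
  "haar_avg m B act f x = (1 / measure m B) * (LINT g:B|m. f (act (- g) x))"

definition quasi_uniform :: "'g::topological_group_add measure \<Rightarrow> (real \<Rightarrow> 'g set) \<Rightarrow> bool" where
  "quasi_uniform m Gt \<longleftrightarrow>
     (\<forall>s t. 0 < s \<and> s \<le> t \<longrightarrow> Gt s \<subseteq> Gt t) \<and>
     (\<forall>t>0. Gt t \<in> sets borel \<and> compact (closure (Gt t)) \<and> emeasure m (Gt t) > 0) \<and>
     (\<forall>\<epsilon>>0. \<exists>U. open U \<and> 0 \<in> U \<and>
        (\<forall>\<^sub>F t in at_top. {u + y | u y. u \<in> U \<and> y \<in> Gt t} \<subseteq> Gt (t + \<epsilon>))) \<and>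
     (\<forall>\<delta>>0. \<exists>\<epsilon>>0. \<forall>\<^sub>F t in at_top.
        emeasure m (Gt (t + \<epsilon>)) \<le> (1 + ennreal \<delta>) * emeasure m (Gt t))"

definition pointwise_ergodic :: "'g::topological_group_add measure \<Rightarrow> (real \<Rightarrow> 'g set)
    \<Rightarrow> ('g \<Rightarrow> 'x \<Rightarrow> 'x) \<Rightarrow> 'x measure \<Rightarrow> ennreal \<Rightarrow> bool" where
  "pointwise_ergodic m Gt act M p \<longleftrightarrow>
     (\<forall>f. memLp M p f \<longrightarrow>
        (AE x in M. ((\<lambda>t. haar_avg m (Gt t) act f x) \<longlongrightarrow> (\<integral>y. f y \<partial>M)) at_top))"

end

theory Submission
  imports Defs
begin

(* For nonnegative f, call x an ergodic point if the averages at x converge to the integral.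
  Quasi-uniformity gives, for h near the identity, h G_t \<subseteq> G_(t+\<epsilon>) and h\<^sup>-\<^sup>1 G_t \<subseteq> G_(t+\<epsilon>),
  so the orbit integrals over G_t at x and at h\<^sup>-\<^sup>1 x bound each other up to a time shift \<epsilon>; since
  m(G_(t+\<epsilon>)) \<le> (1 + \<delta>) m(G_t), x is an ergodic point as soon as every neighbourhood of the
  identity contains some h with h\<^sup>-\<^sup>1 x ergodic.  By Fubini and left invariance of m, the points x
  for which h\<^sup>-\<^sup>1 x is ergodic for m-almost every h form a G-invariant conull set, and such h exist
  in every neighbourhood of the identity because Haar measure charges open sets.  A signed f is
  split into positive and negative parts. *)

lemma eventually_at_top_shift:
  fixes c :: real
  assumes "eventually P at_top"
  shows "eventually (\<lambda>t. P (t + c)) at_top"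
proof -
  obtain N where "\<And>t. t \<ge> N \<Longrightarrow> P t" using assms unfolding eventually_at_top_linorder by blast
  then have "\<And>t. t \<ge> N - c \<Longrightarrow> P (t + c)" by force
  then show ?thesis unfolding eventually_at_top_linorder by blast
qed

lemma ratio_shift_upper_bound:
  fixes a b \<mu> :: "real \<Rightarrow> real"
  assumes nonneg: "\<And>t. 0 \<le> a t" and \<delta>: "0 \<le> \<delta>"
    and ratio: "\<forall>\<^sub>F t in at_top. a t / \<mu> t < C" and pos: "\<forall>\<^sub>F t in at_top. 0 < \<mu> t"
    and growth: "\<forall>\<^sub>F t in at_top. \<mu> (t + \<epsilon>) \<le> (1 + \<delta>) * \<mu> t"
    and le: "\<forall>\<^sub>F t in at_top. b t \<le> a (t + \<epsilon>)"
  shows "\<forall>\<^sub>F t in at_top. b t \<le> C * (1 + \<delta>) * \<mu> t"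
  using ratio[THEN eventually_at_top_shift[where c = \<epsilon>]] pos[THEN eventually_at_top_shift[where c = \<epsilon>]]
    growth le pos
proof eventually_elim
  case (elim t)
  have "b t \<le> a (t + \<epsilon>) / \<mu> (t + \<epsilon>) * \<mu> (t + \<epsilon>)"
    using elim by simp
  also have "\<dots> \<le> a (t + \<epsilon>) / \<mu> (t + \<epsilon>) * ((1 + \<delta>) * \<mu> t)"
    using elim nonneg by (intro mult_left_mono) auto
  also have "\<dots> \<le> C * ((1 + \<delta>) * \<mu> t)"
    using elim \<delta> by (intro mult_right_mono) auto
  finally show ?case by (simp add: mult.assoc)
qed

lemma ratio_shift_lower_bound:
  fixes a b \<mu> :: "real \<Rightarrow> real"
  assumes nonneg: "\<And>t. 0 \<le> a t" and \<delta>: "0 \<le> \<delta>"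
    and ratio: "\<forall>\<^sub>F t in at_top. C < a t / \<mu> t" and pos: "\<forall>\<^sub>F t in at_top. 0 < \<mu> t"
    and growth: "\<forall>\<^sub>F t in at_top. \<mu> (t + \<epsilon>) \<le> (1 + \<delta>) * \<mu> t"
    and le: "\<forall>\<^sub>F t in at_top. a t \<le> b (t + \<epsilon>)"
  shows "\<forall>\<^sub>F t in at_top. C * \<mu> t \<le> (1 + \<delta>) * b t"
  using ratio[THEN eventually_at_top_shift[where c = "- \<epsilon>"]] pos[THEN eventually_at_top_shift[where c = "- \<epsilon>"]]
    growth[THEN eventually_at_top_shift[where c = "- \<epsilon>"]] le[THEN eventually_at_top_shift[where c = "- \<epsilon>"]] pos
proof eventually_elim
  case (elim t)
  define s where "s = t - \<epsilon>"
  have s: "C < a s / \<mu> s" "0 < \<mu> s" "\<mu> t \<le> (1 + \<delta>) * \<mu> s" "a s \<le> b t"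
    using elim by (simp_all add: s_def)
  have "C * (\<mu> t / (1 + \<delta>)) \<le> a s / \<mu> s * (\<mu> t / (1 + \<delta>))"
    using s elim \<delta> by (intro mult_right_mono) auto
  also have "\<dots> \<le> a s / \<mu> s * \<mu> s"
    using s nonneg \<delta> by (intro mult_left_mono) (auto simp: divide_le_eq mult.commute)
  also have "\<dots> \<le> b t"
    using s by simp
  finally show ?case
    using \<delta> by (simp add: field_simps)
qed

lemma tendsto_ratio_sandwich:
  fixes b \<mu> :: "real \<Rightarrow> real"
  assumes \<mu>_pos: "\<forall>\<^sub>F t in at_top. 0 < \<mu> t"
    and \<mu>_growth: "\<And>\<delta>. 0 < \<delta> \<Longrightarrow> \<exists>\<epsilon>>0. \<forall>\<^sub>F t in at_top. \<mu> (t + \<epsilon>) \<le> (1 + \<delta>) * \<mu> t"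
    and approx: "\<And>\<epsilon>. 0 < \<epsilon> \<Longrightarrow> \<exists>a. (\<forall>t. 0 \<le> a t) \<and> ((\<lambda>t. a t / \<mu> t) \<longlongrightarrow> c) at_top \<and>
                   (\<forall>\<^sub>F t in at_top. b t \<le> a (t + \<epsilon>) \<and> a t \<le> b (t + \<epsilon>))"
  shows "((\<lambda>t. b t / \<mu> t) \<longlongrightarrow> c) at_top"
  unfolding tendsto_iff dist_real_def
proof (intro allI impI)
  fix e :: real assume e: "0 < e"
  define \<delta> where "\<delta> = e / (2 * (\<bar>c\<bar> + e))"
  have "0 < \<bar>c\<bar> + e" using e by simp
  then have \<delta>: "0 < \<delta>" "\<delta> * (\<bar>c\<bar> + e) = e / 2"
    using e by (simp_all add: \<delta>_def field_simps)
  have "\<delta> * (c + e / 2) < \<delta> * (\<bar>c\<bar> + e)" "\<delta> * (c - e) < \<delta> * (\<bar>c\<bar> + e)"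
    using \<delta> e by (auto intro!: mult_strict_left_mono)
  moreover have "(c + e / 2) * (1 + \<delta>) = c + e / 2 + \<delta> * (c + e / 2)"
    "(c - e) * (1 + \<delta>) = c - e + \<delta> * (c - e)" by algebra+
  ultimately have upper_coeff: "(c + e / 2) * (1 + \<delta>) < c + e"
    and lower_coeff: "(c - e) * (1 + \<delta>) < c - e / 2"
    using \<delta>(2) by linarith+
  obtain \<epsilon> where "0 < \<epsilon>" and growth: "\<forall>\<^sub>F t in at_top. \<mu> (t + \<epsilon>) \<le> (1 + \<delta>) * \<mu> t"
    using \<mu>_growth[OF \<delta>(1)] by blast
  then obtain a where a_nonneg: "\<And>t. 0 \<le> a t" and a_lim: "((\<lambda>t. a t / \<mu> t) \<longlongrightarrow> c) at_top"
    and ab: "\<forall>\<^sub>F t in at_top. b t \<le> a (t + \<epsilon>) \<and> a t \<le> b (t + \<epsilon>)"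
    using approx by blast
  have "\<forall>\<^sub>F t in at_top. \<bar>a t / \<mu> t - c\<bar> < e / 2"
    using tendstoD[OF a_lim, of "e / 2"] e by (simp add: dist_real_def)
  then have "\<forall>\<^sub>F t in at_top. a t / \<mu> t < c + e / 2" "\<forall>\<^sub>F t in at_top. c - e / 2 < a t / \<mu> t"
    by (eventually_elim, simp only: abs_diff_less_iff)+
  moreover have "\<forall>\<^sub>F t in at_top. b t \<le> a (t + \<epsilon>)" "\<forall>\<^sub>F t in at_top. a t \<le> b (t + \<epsilon>)"
    using ab by (eventually_elim, simp)+
  ultimately have "\<forall>\<^sub>F t in at_top. b t \<le> (c + e / 2) * (1 + \<delta>) * \<mu> t"
    and "\<forall>\<^sub>F t in at_top. (c - e / 2) * \<mu> t \<le> (1 + \<delta>) * b t"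
    using a_nonneg \<delta>(1) \<mu>_pos growth
    by (auto intro!: ratio_shift_upper_bound[of a] ratio_shift_lower_bound[of a])
  then show "\<forall>\<^sub>F t in at_top. \<bar>b t / \<mu> t - c\<bar> < e"
    using \<mu>_pos
  proof eventually_elim
    case (elim t)
    have "b t < (c + e) * \<mu> t"
      using elim mult_strict_right_mono[OF upper_coeff, of "\<mu> t"] by linarith
    moreover have "(1 + \<delta>) * ((c - e) * \<mu> t) < (1 + \<delta>) * b t"
      using elim mult_strict_right_mono[OF lower_coeff, of "\<mu> t"] by (simp add: algebra_simps)
    then have "(c - e) * \<mu> t < b t"
      using \<delta>(1) by simp
    ultimately show ?case
      using elim by (simp add: abs_diff_less_iff pos_divide_less_eq pos_less_divide_eq)
  qed
qed

lemma left_haar_measure_sigma_finite: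
  fixes m :: "'g::{topological_group_add, second_countable_topology, t2_space} measure"
  assumes lc: "locally_compact_space (euclidean :: 'g topology)"
    and haar: "left_haar_measure m"
  shows "sigma_finite_measure m"
proof
  have sets_m: "sets m = sets borel" and fin: "\<And>K. compact K \<Longrightarrow> emeasure m K < \<infinity>"
    using haar by (auto simp: left_haar_measure_def)
  obtain B :: "'g set set" where B: "countable B" "topological_basis B"
    using ex_countable_basis by blast
  define A where "A = {b \<in> B. \<exists>K. compact K \<and> b \<subseteq> K}"
  have "x \<in> \<Union>A" for x
  proof -
    have "\<exists>U K. open U \<and> compact K \<and> x \<in> U \<and> U \<subseteq> K"
      using lc unfolding locally_compact_space_def by auto
    then obtain U K where "open U" "compact K" "x \<in> U" "U \<subseteq> K"
      by blast
    then obtain b where "b \<in> B" "x \<in> b" "b \<subseteq> U"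
      using topological_basisE[OF B(2)] by metis
    then show ?thesis unfolding A_def using \<open>compact K\<close> \<open>U \<subseteq> K\<close> by blast
  qed
  then have "\<Union>A = space m"
    using sets_eq_imp_space_eq[OF sets_m] by auto
  moreover have "emeasure m a \<noteq> \<infinity>" if "a \<in> A" for a
  proof -
    obtain K where K: "compact K" "a \<subseteq> K" and "open a"
      using \<open>a \<in> A\<close> B(2) unfolding A_def topological_basis_def by auto
    have "emeasure m a \<le> emeasure m K"
      using K \<open>open a\<close> by (intro emeasure_mono) (auto simp: sets_m intro: borel_closed compact_imp_closed)
    then show ?thesis using fin[OF K(1)] by (auto simp: top_unique)
  qed
  moreover have "countable A" "A \<subseteq> sets m"
    using B unfolding A_def sets_m by (auto simp: topological_basis_def)
  ultimately show "\<exists>A. countable A \<and> A \<subseteq> sets m \<and> \<Union> A = space m \<and> (\<forall>a\<in>A. emeasure m a \<noteq> \<infinity>)"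
    by blast
qed

lemma quasi_uniform_mono: "quasi_uniform m Gt \<Longrightarrow> 0 < s \<Longrightarrow> s \<le> t \<Longrightarrow> Gt s \<subseteq> Gt t"
  by (simp add: quasi_uniform_def)

lemma quasi_uniform_sets: "quasi_uniform m Gt \<Longrightarrow> 0 < t \<Longrightarrow> Gt t \<in> sets borel"
  by (simp add: quasi_uniform_def)

lemma quasi_uniform_emeasure_eq_measure:
  assumes "quasi_uniform m Gt" "left_haar_measure m" "0 < t"
  shows "emeasure m (Gt t) = ennreal (measure m (Gt t))"
proof -
  have "compact (closure (Gt t))" and sets_m: "sets m = sets borel"
    using assms by (auto simp: quasi_uniform_def left_haar_measure_def)
  have "emeasure m (Gt t) \<le> emeasure m (closure (Gt t))"
    by (rule emeasure_mono) (auto simp: sets_m closure_subset)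
  also have "\<dots> < \<infinity>"
    using assms(2) \<open>compact (closure (Gt t))\<close> by (simp add: left_haar_measure_def)
  finally show ?thesis
    by (intro emeasure_eq_ennreal_measure) simp
qed

lemma quasi_uniform_measure_pos:
  assumes "quasi_uniform m Gt" "left_haar_measure m" "0 < t"
  shows "0 < measure m (Gt t)"
proof -
  have "0 < emeasure m (Gt t)"
    using assms by (simp add: quasi_uniform_def)
  then show ?thesis
    using quasi_uniform_emeasure_eq_measure[OF assms] by simp
qed

lemma quasi_uniform_measure_growth:
  assumes "quasi_uniform m Gt" "left_haar_measure m" "0 < \<delta>"
  shows "\<exists>\<epsilon>>0. \<forall>\<^sub>F t in at_top. measure m (Gt (t + \<epsilon>)) \<le> (1 + \<delta>) * measure m (Gt t)"
proof -
  obtain \<epsilon> where \<epsilon>: "0 < \<epsilon>"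
    and growth: "\<forall>\<^sub>F t in at_top. emeasure m (Gt (t + \<epsilon>)) \<le> (1 + ennreal \<delta>) * emeasure m (Gt t)"
    using assms(1,3) unfolding quasi_uniform_def by blast
  have "\<forall>\<^sub>F t in at_top. measure m (Gt (t + \<epsilon>)) \<le> (1 + \<delta>) * measure m (Gt t)"
    using growth eventually_gt_at_top[of 0]
  proof eventually_elim
    case (elim t)
    then have "ennreal (measure m (Gt (t + \<epsilon>))) \<le> (1 + ennreal \<delta>) * ennreal (measure m (Gt t))"
      using \<epsilon> quasi_uniform_emeasure_eq_measure[OF assms(1,2)] by simp
    also have "\<dots> = ennreal ((1 + \<delta>) * measure m (Gt t))"
      using assms(3) by (simp add: ennreal_mult)
    finally show ?case
      using assms(3) quasi_uniform_measure_pos[OF assms(1,2) \<open>0 < t\<close>] by (simp add: ennreal_le_iff)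
  qed
  with \<epsilon> show ?thesis by blast
qed

lemma quasi_uniform_translate:
  fixes Gt :: "real \<Rightarrow> 'g::topological_group_add set"
  assumes "quasi_uniform m Gt" "0 < \<epsilon>"
  shows "\<exists>U. open U \<and> 0 \<in> U \<and> (\<forall>\<^sub>F t in at_top. \<forall>h\<in>U. \<forall>v.
           (h + v \<in> Gt t \<longrightarrow> v \<in> Gt (t + \<epsilon>)) \<and> (- h + v \<in> Gt t \<longrightarrow> v \<in> Gt (t + \<epsilon>)))"
proof -
  obtain U where U: "open U" "0 \<in> U"
    and UG: "\<forall>\<^sub>F t in at_top. {u + y | u y. u \<in> U \<and> y \<in> Gt t} \<subseteq> Gt (t + \<epsilon>)"
    using assms unfolding quasi_uniform_def by blast
  have "open (uminus -` U)"
    by (rule open_vimage[OF U(1)]) (intro continuous_intros)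
  then have "open (U \<inter> uminus -` U)"
    using U(1) by blast
  moreover have "\<forall>\<^sub>F t in at_top. \<forall>h\<in>U \<inter> uminus -` U. \<forall>v.
           (h + v \<in> Gt t \<longrightarrow> v \<in> Gt (t + \<epsilon>)) \<and> (- h + v \<in> Gt t \<longrightarrow> v \<in> Gt (t + \<epsilon>))"
    using UG
  proof eventually_elim
    case (elim t)
    have "v \<in> Gt (t + \<epsilon>)" if "- h \<in> U" "h + v \<in> Gt t" for h v
      using elim that by (force simp: add.assoc[symmetric])
    moreover have "v \<in> Gt (t + \<epsilon>)" if "h \<in> U" "- h + v \<in> Gt t" for h v
      using elim that by (force simp: add.assoc[symmetric])
    ultimately show ?case by blast
  qed
  ultimately show ?thesis using U(2) by (intro exI[of _ "U \<inter> uminus -` U"]) auto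
qed

lemma memLp_mono:
  fixes f g :: "'x \<Rightarrow> real"
  assumes f: "memLp M p f" and g: "g \<in> borel_measurable M" and le: "\<And>z. \<bar>g z\<bar> \<le> \<bar>f z\<bar>"
  shows "memLp M p g"
proof (cases "p = \<infinity>")
  case True
  then obtain C where "AE x in M. \<bar>f x\<bar> \<le> C" using f by (auto simp: memLp_def)
  then have "AE x in M. \<bar>g x\<bar> \<le> C" by eventually_elim (rule order_trans[OF le])
  then show ?thesis using True g by (auto simp: memLp_def)
next
  case False
  have "(\<integral>\<^sup>+ x. ennreal (\<bar>g x\<bar> powr enn2real p) \<partial>M) \<le> (\<integral>\<^sup>+ x. ennreal (\<bar>f x\<bar> powr enn2real p) \<partial>M)"
    by (intro nn_integral_mono ennreal_leI powr_mono2 le) auto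
  also have "\<dots> < \<infinity>" using f False by (simp add: memLp_def)
  finally show ?thesis using False g by (simp add: memLp_def)
qed

lemma (in prob_space) memLp_integrable:
  fixes f :: "'a \<Rightarrow> real"
  assumes f: "memLp M p f" and p: "1 \<le> p"
  shows "integrable M f"
proof (cases "p = \<infinity>")
  case True
  then obtain C where "AE x in M. norm (f x) \<le> C" using f by (auto simp: memLp_def)
  moreover have "f \<in> borel_measurable M" using f by (simp add: memLp_def)
  ultimately show ?thesis by (rule integrable_const_bound)
next
  case False
  define r where "r = enn2real p"
  have "enn2real 1 \<le> enn2real p" using p False by (intro enn2real_mono) (auto simp: less_top)
  then have r: "1 \<le> r" unfolding r_def by simp
  have fm: "f \<in> borel_measurable M" using f by (simp add: memLp_def)
  have fin: "(\<integral>\<^sup>+ x. ennreal (\<bar>f x\<bar> powr r) \<partial>M) < \<infinity>"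
    using f False by (simp add: memLp_def r_def)
  have "\<bar>y\<bar> \<le> 1 + \<bar>y\<bar> powr r" for y :: real
  proof (cases "\<bar>y\<bar> \<le> 1")
    case False
    then have "\<bar>y\<bar> powr 1 \<le> \<bar>y\<bar> powr r" using r by (intro powr_mono) auto
    then show ?thesis using False by simp
  qed (use powr_ge_zero[of "\<bar>y\<bar>" r] in linarith)
  then have "ennreal (norm (f x)) \<le> 1 + ennreal (\<bar>f x\<bar> powr r)" for x
    using ennreal_leI[of "norm (f x)" "1 + \<bar>f x\<bar> powr r"] by (simp add: ennreal_plus)
  then have "(\<integral>\<^sup>+ x. ennreal (norm (f x)) \<partial>M) \<le> (\<integral>\<^sup>+ x. 1 + ennreal (\<bar>f x\<bar> powr r) \<partial>M)"
    by (intro nn_integral_mono)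
  also have "\<dots> = (\<integral>\<^sup>+ x. 1 \<partial>M) + (\<integral>\<^sup>+ x. ennreal (\<bar>f x\<bar> powr r) \<partial>M)"
    using fm by (intro nn_integral_add) auto
  also have "\<dots> < \<infinity>"
    using fin by (simp add: emeasure_space_1)
  finally show ?thesis by (intro integrableI_bounded fm)
qed

definition orbit_integral :: "('g::uminus) measure \<Rightarrow> ('g \<Rightarrow> 'x \<Rightarrow> 'x) \<Rightarrow> ('x \<Rightarrow> real) \<Rightarrow> 'g set \<Rightarrow> 'x \<Rightarrow> ennreal"
  where "orbit_integral m act F B x = (\<integral>\<^sup>+ g. indicator B g * ennreal (F (act (- g) x)) \<partial>m)"

(* Finiteness of the orbit integrals is recorded because haar_avg is a Bochner integral, which
  is 0 on non-integrable functions. *)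
definition ergodic_point :: "'g::topological_group_add measure \<Rightarrow> (real \<Rightarrow> 'g set) \<Rightarrow> ('g \<Rightarrow> 'x \<Rightarrow> 'x)
    \<Rightarrow> 'x measure \<Rightarrow> ('x \<Rightarrow> real) \<Rightarrow> 'x \<Rightarrow> bool"
  where "ergodic_point m Gt act M F x \<longleftrightarrow>
    (\<forall>\<^sub>F t in at_top. orbit_integral m act F (Gt t) x \<noteq> \<infinity>) \<and>
    ((\<lambda>t. haar_avg m (Gt t) act F x) \<longlongrightarrow> (\<integral>y. F y \<partial>M)) at_top"

locale haar_action = prob_space M for M :: "'x measure" +
  fixes m :: "'g::{topological_group_add, second_countable_topology, t2_space} measure"
    and act :: "'g \<Rightarrow> 'x \<Rightarrow> 'x"
  assumes locally_compact: "locally_compact_space (euclidean :: 'g topology)"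
    and haar: "left_haar_measure m"
    and space_M: "space M = UNIV"
    and action: "mp_action act M"
begin

lemma sets_m: "sets m = sets borel"
  using haar by (simp add: left_haar_measure_def)

lemma space_m [simp]: "space m = UNIV"
  using sets_eq_imp_space_eq[OF sets_m] by simp

sublocale m: sigma_finite_measure m
  by (rule left_haar_measure_sigma_finite[OF locally_compact haar])

sublocale Mm: pair_sigma_finite M m ..

lemma act_zero [simp]: "act 0 x = x"
  using action space_M by (simp add: mp_action_def)

lemma act_add: "act (g + h) x = act g (act h x)"
  using action space_M by (simp add: mp_action_def)

lemma act_neg_cancel [simp]: "act h (act (- h) x) = x"
  by (simp add: act_add[symmetric])

lemma distr_act: "distr M M (act g) = M"
  using action by (simp add: mp_action_def)

lemma measurable_orbit_map: "(\<lambda>(x, g). act (- g) x) \<in> measurable (M \<Otimes>\<^sub>M m) M"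
proof -
  have "(uminus :: 'g \<Rightarrow> 'g) \<in> measurable m borel"
    unfolding measurable_cong_sets[OF sets_m refl]
    by (rule borel_measurable_continuous_onI) (intro continuous_intros)
  then have "(\<lambda>(x, g). (- g, x)) \<in> measurable (M \<Otimes>\<^sub>M m) (borel \<Otimes>\<^sub>M M)"
    by measurable
  moreover have "(\<lambda>(g, x). act g x) \<in> measurable (borel \<Otimes>\<^sub>M M) M"
    using action by (simp add: mp_action_def)
  ultimately show ?thesis
    by (rule measurable_comp[THEN measurable_cong[THEN iffD1, rotated]]) auto
qed

lemma measurable_act_neg: "act (- g) \<in> measurable M M"
  using measurable_Pair1[OF measurable_orbit_map, of g] by simp

lemma measurable_orbit: "(\<lambda>g. act (- g) x) \<in> measurable m M"
  using measurable_Pair2[OF measurable_orbit_map, of x] by (simp add: space_M)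

lemma measurable_translate: "(\<lambda>v. h + v) \<in> measurable m m"
  unfolding measurable_cong_sets[OF sets_m sets_m]
  by (rule borel_measurable_continuous_onI) (intro continuous_intros)

lemma distr_translate: "distr m m (\<lambda>v. h + v) = m"
proof (rule measure_eqI)
  fix A assume "A \<in> sets (distr m m (\<lambda>v. h + v))"
  then have A: "A \<in> sets borel" by (simp add: sets_m)
  have "(\<lambda>v. h + v) -` A = (\<lambda>v. - h + v) ` A"
    by (auto simp: image_iff add.assoc[symmetric]) (metis add.assoc add.left_inverse add_0)
  then show "emeasure (distr m m (\<lambda>v. h + v)) A = emeasure m A"
    using haar A by (simp add: emeasure_distr[OF measurable_translate] sets_m left_haar_measure_def)
qed simp

lemma borel_measurable_orbit_integrand:
  assumes F: "F \<in> borel_measurable M" and B: "B \<in> sets borel"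
  shows "(\<lambda>(x, g). indicator B g * ennreal (F (act (- g) x))) \<in> borel_measurable (M \<Otimes>\<^sub>M m)"
proof -
  have "(\<lambda>(x, g). F (act (- g) x)) \<in> borel_measurable (M \<Otimes>\<^sub>M m)"
    using measurable_comp[OF measurable_orbit_map F] by (simp add: comp_def case_prod_beta')
  moreover have "(\<lambda>(x, g). indicator B g :: ennreal) \<in> borel_measurable (M \<Otimes>\<^sub>M m)"
    unfolding case_prod_beta'
    using B by (intro measurable_compose[OF measurable_snd] borel_measurable_indicator) (simp add: sets_m)
  ultimately show ?thesis
    by (simp add: case_prod_beta')
qed

lemma orbit_integral_translate_le:
  assumes F: "F \<in> borel_measurable M" and B: "B \<in> sets borel"
    and BB': "\<And>v. h + v \<in> B \<Longrightarrow> v \<in> B'"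
  shows "orbit_integral m act F B (act h y) \<le> orbit_integral m act F B' y"
proof -
  have "orbit_integral m act F B (act h y)
      = (\<integral>\<^sup>+ u. indicator B u * ennreal (F (act (- u) (act h y))) \<partial>distr m m (\<lambda>v. h + v))"
    by (simp add: orbit_integral_def distr_translate)
  also have "\<dots> = (\<integral>\<^sup>+ v. indicator B (h + v) * ennreal (F (act (- (h + v)) (act h y))) \<partial>m)"
    using measurable_Pair2[OF borel_measurable_orbit_integrand[OF F B], of "act h y"]
    by (intro nn_integral_distr measurable_translate) (simp_all add: distr_translate space_M)
  also have "\<dots> = (\<integral>\<^sup>+ v. indicator B (h + v) * ennreal (F (act (- v) y)) \<partial>m)"
    by (simp add: act_add[symmetric] minus_add add.assoc)
  also have "\<dots> \<le> orbit_integral m act F B' y"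
    unfolding orbit_integral_def
    by (intro nn_integral_mono mult_right_mono) (auto simp: indicator_def BB')
  finally show ?thesis .
qed

lemma haar_avg_eq_orbit_integral:
  assumes F: "F \<in> borel_measurable M" and nonneg: "\<And>z. 0 \<le> F z" and B: "B \<in> sets borel"
  shows "haar_avg m B act F x = enn2real (orbit_integral m act F B x) / measure m B"
proof -
  have "(LINT g:B|m. F (act (- g) x))
      = enn2real (\<integral>\<^sup>+ g. ennreal (indicator B g *\<^sub>R F (act (- g) x)) \<partial>m)"
    unfolding set_lebesgue_integral_def
    using measurable_compose[OF measurable_orbit F] B nonneg
    by (intro integral_eq_nn_integral borel_measurable_scaleR borel_measurable_indicator) (auto simp: sets_m)
  also have "(\<integral>\<^sup>+ g. ennreal (indicator B g *\<^sub>R F (act (- g) x)) \<partial>m) = orbit_integral m act F B x"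
    unfolding orbit_integral_def by (intro nn_integral_cong) (simp add: indicator_def)
  finally show ?thesis by (simp add: haar_avg_def)
qed

lemma set_integrable_orbit:
  assumes F: "F \<in> borel_measurable M" and nonneg: "\<And>z. 0 \<le> F z" and B: "B \<in> sets borel"
    and fin: "orbit_integral m act F B x \<noteq> \<infinity>"
  shows "set_integrable m B (\<lambda>g. F (act (- g) x))"
  unfolding set_integrable_def
proof (rule integrableI_bounded)
  show "(\<lambda>g. indicator B g *\<^sub>R F (act (- g) x)) \<in> borel_measurable m"
    using measurable_compose[OF measurable_orbit F] B
    by (intro borel_measurable_scaleR borel_measurable_indicator) (auto simp: sets_m)
  have "(\<integral>\<^sup>+ g. ennreal (norm (indicator B g *\<^sub>R F (act (- g) x))) \<partial>m) = orbit_integral m act F B x"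
    unfolding orbit_integral_def by (intro nn_integral_cong) (simp add: indicator_def nonneg)
  then show "(\<integral>\<^sup>+ g. ennreal (norm (indicator B g *\<^sub>R F (act (- g) x))) \<partial>m) < \<infinity>"
    using fin by (simp add: less_top)
qed

lemma nn_integral_orbit_integral:
  assumes F: "F \<in> borel_measurable M" and B: "B \<in> sets borel"
  shows "(\<integral>\<^sup>+ x. orbit_integral m act F B x \<partial>M) = emeasure m B * (\<integral>\<^sup>+ x. ennreal (F x) \<partial>M)"
proof -
  have "(\<integral>\<^sup>+ x. orbit_integral m act F B x \<partial>M)
      = (\<integral>\<^sup>+ g. indicator B g * (\<integral>\<^sup>+ x. ennreal (F (act (- g) x)) \<partial>M) \<partial>m)"
    unfolding orbit_integral_def
    using Mm.Fubini'[OF borel_measurable_orbit_integrand[OF F B]]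
    using measurable_comp[OF measurable_act_neg F]
    by (simp add: nn_integral_cmult comp_def)
  also have "\<dots> = (\<integral>\<^sup>+ g. indicator B g * (\<integral>\<^sup>+ x. ennreal (F x) \<partial>M) \<partial>m)"
    using nn_integral_distr[OF measurable_act_neg, of "\<lambda>x. ennreal (F x)"] F
    by (simp add: distr_act)
  also have "\<dots> = emeasure m B * (\<integral>\<^sup>+ x. ennreal (F x) \<partial>M)"
    using nn_integral_cmult_indicator[of B m "\<integral>\<^sup>+ x. ennreal (F x) \<partial>M"] B
    by (simp add: sets_m mult.commute)
  finally show ?thesis .
qed

lemma AE_orbit_integral_finite:
  assumes F: "F \<in> borel_measurable M" and int: "integrable M F" and nonneg: "\<And>z. 0 \<le> F z"
    and B: "B \<in> sets borel" and fin: "emeasure m B < \<infinity>"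
  shows "AE x in M. orbit_integral m act F B x \<noteq> \<infinity>"
proof (rule nn_integral_PInf_AE)
  show "orbit_integral m act F B \<in> borel_measurable M"
    unfolding orbit_integral_def
    using m.borel_measurable_nn_integral[OF borel_measurable_orbit_integrand[OF F B]]
    by (simp add: case_prod_beta')
  have "(\<integral>\<^sup>+ x. ennreal (F x) \<partial>M) < \<infinity>"
    using integrableD(2)[OF int] nonneg by (simp add: less_top)
  then show "(\<integral>\<^sup>+ x. orbit_integral m act F B x \<partial>M) \<noteq> \<infinity>"
    using fin by (simp add: nn_integral_orbit_integral[OF F B] ennreal_mult_eq_top_iff less_top[symmetric])
qed

lemma sets_orbit_preimage: "N \<in> sets M \<Longrightarrow> {g. act (- g) x \<in> N} \<in> sets m"
  using measurable_sets[OF measurable_orbit] by (simp add: vimage_def)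

lemma AE_emeasure_orbit_preimage_null:
  assumes N: "N \<in> sets M" "emeasure M N = 0"
  shows "AE x in M. emeasure m {g. act (- g) x \<in> N} = 0"
proof -
  have "AE x in M. act (- g) x \<notin> N" for g
  proof (rule AE_I')
    have "emeasure M (act (- g) -` N \<inter> space M) = emeasure (distr M M (act (- g))) N"
      using N(1) measurable_act_neg by (simp add: emeasure_distr)
    then show "act (- g) -` N \<inter> space M \<in> null_sets M"
      using N measurable_act_neg by (simp add: distr_act null_sets_def)
  qed auto
  then have "AE g in m. AE x in M. act (- g) x \<notin> N"
    by simp
  moreover have "{p \<in> space (M \<Otimes>\<^sub>M m). act (- snd p) (fst p) \<notin> N} \<in> sets (M \<Otimes>\<^sub>M m)"
    using measurable_orbit_map N(1) by (simp add: case_prod_beta' pred_def)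
  ultimately have "AE x in M. AE g in m. act (- g) x \<notin> N"
    by (subst Mm.AE_commute)
  then show ?thesis
  proof eventually_elim
    case (elim x)
    then show ?case
      using AE_iff_measurable[OF sets_orbit_preimage[OF N(1)], of "\<lambda>g. act (- g) x \<notin> N"] by simp
  qed
qed

lemma emeasure_orbit_preimage_act:
  assumes N: "N \<in> sets M"
  shows "emeasure m {g. act (- g) (act h x) \<in> N} = emeasure m {g. act (- g) x \<in> N}"
proof -
  have "act (- g) (act h x) = act (- (- h + g)) x" for g
    by (simp add: act_add[symmetric] minus_add)
  then have "{g. act (- g) (act h x) \<in> N} = (\<lambda>u. h + u) ` {g. act (- g) x \<in> N}"
    by (auto simp: image_iff) (metis add.assoc add.right_inverse add_0)
  then show ?thesis
    using haar sets_orbit_preimage[OF N] by (simp add: left_haar_measure_def sets_m)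
qed

lemma AE_imp_invariant_conull_set:
  assumes "AE x in M. P x"
  shows "\<exists>\<Omega>\<in>sets M. emeasure M \<Omega> = 1 \<and> (\<forall>g x. act g x \<in> \<Omega> \<longleftrightarrow> x \<in> \<Omega>) \<and>
           (\<forall>x\<in>\<Omega>. \<forall>V. open V \<longrightarrow> 0 \<in> V \<longrightarrow> (\<exists>h\<in>V. P (act (- h) x)))"
proof -
  obtain N where N: "{x \<in> space M. \<not> P x} \<subseteq> N" "emeasure M N = 0" "N \<in> sets M"
    using assms by (rule AE_E)
  define \<Omega> where "\<Omega> = {x. emeasure m {g. act (- g) x \<in> N} = 0}"
  have "(\<lambda>x. emeasure m {g. act (- g) x \<in> N}) \<in> borel_measurable M"
    using m.measurable_emeasure_Pair[OF measurable_sets[OF measurable_orbit_map N(3)]]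
    by (simp add: vimage_def space_pair_measure space_M)
  then have "(\<lambda>x. emeasure m {g. act (- g) x \<in> N}) -` {0} \<inter> space M \<in> sets M"
    by (rule measurable_sets) simp
  then have "\<Omega> \<in> sets M"
    by (simp add: \<Omega>_def vimage_def space_M)
  moreover have "emeasure M \<Omega> = 1"
    using AE_emeasure_orbit_preimage_null[OF N(3,2)] \<open>\<Omega> \<in> sets M\<close>
    by (intro emeasure_eq_1_AE) (simp_all add: \<Omega>_def)
  moreover have "act g x \<in> \<Omega> \<longleftrightarrow> x \<in> \<Omega>" for g x
    by (simp add: \<Omega>_def emeasure_orbit_preimage_act[OF N(3)])
  moreover have "\<exists>h\<in>V. P (act (- h) x)" if "x \<in> \<Omega>" "open V" "0 \<in> V" for x V
  proof (rule ccontr)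
    assume "\<not> (\<exists>h\<in>V. P (act (- h) x))"
    then have "V \<subseteq> {g. act (- g) x \<in> N}"
      using N(1) by (auto simp: space_M)
    then have "emeasure m V \<le> emeasure m {g. act (- g) x \<in> N}"
      by (rule emeasure_mono) (rule sets_orbit_preimage[OF N(3)])
    also have "\<dots> = 0"
      using \<open>x \<in> \<Omega>\<close> by (simp add: \<Omega>_def)
    finally have "emeasure m V = 0" by simp
    moreover have "0 < emeasure m V"
      using haar that by (auto simp: left_haar_measure_def)
    ultimately show False by simp
  qed
  ultimately show ?thesis by blast
qed

lemma orbit_integral_mono: "B \<subseteq> B' \<Longrightarrow> orbit_integral m act F B x \<le> orbit_integral m act F B' x"
  unfolding orbit_integral_def by (intro nn_integral_mono mult_right_mono) (auto simp: indicator_def)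

lemma haar_avg_eq_orbit_integral_eventually:
  assumes qu: "quasi_uniform m Gt" and F: "F \<in> borel_measurable M" and nonneg: "\<And>z. 0 \<le> F z"
  shows "\<forall>\<^sub>F t in at_top.
           haar_avg m (Gt t) act F x = enn2real (orbit_integral m act F (Gt t) x) / measure m (Gt t)"
  using eventually_gt_at_top[of 0]
  by eventually_elim (rule haar_avg_eq_orbit_integral[OF F nonneg quasi_uniform_sets[OF qu]])

lemma orbit_integral_near_bounds:
  assumes qu: "quasi_uniform m Gt" and F: "F \<in> borel_measurable M" and \<epsilon>: "0 < \<epsilon>"
    and near: "\<And>V. open V \<Longrightarrow> 0 \<in> V \<Longrightarrow> \<exists>h\<in>V. P (act (- h) x)"
  shows "\<exists>y. P y \<and> (\<forall>\<^sub>F t in at_top.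
           orbit_integral m act F (Gt t) x \<le> orbit_integral m act F (Gt (t + \<epsilon>)) y \<and>
           orbit_integral m act F (Gt t) y \<le> orbit_integral m act F (Gt (t + \<epsilon>)) x)"
proof -
  obtain U where U: "open U" "0 \<in> U" and UG: "\<forall>\<^sub>F t in at_top. \<forall>h\<in>U. \<forall>v.
      (h + v \<in> Gt t \<longrightarrow> v \<in> Gt (t + \<epsilon>)) \<and> (- h + v \<in> Gt t \<longrightarrow> v \<in> Gt (t + \<epsilon>))"
    using quasi_uniform_translate[OF qu \<epsilon>] by blast
  obtain h where h: "h \<in> U" "P (act (- h) x)"
    using near[OF U] by blast
  have "\<forall>\<^sub>F t in at_top.
           orbit_integral m act F (Gt t) (act h (act (- h) x)) \<le> orbit_integral m act F (Gt (t + \<epsilon>)) (act (- h) x) \<and>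
           orbit_integral m act F (Gt t) (act (- h) x) \<le> orbit_integral m act F (Gt (t + \<epsilon>)) x"
    using UG eventually_gt_at_top[of 0]
  proof eventually_elim
    case (elim t)
    then show ?case
      using h(1) quasi_uniform_sets[OF qu \<open>0 < t\<close>]
      by (intro conjI orbit_integral_translate_le[OF F]) auto
  qed
  with h(2) show ?thesis by auto
qed

lemma ergodic_point_if_near:
  assumes qu: "quasi_uniform m Gt" and F: "F \<in> borel_measurable M" and nonneg: "\<And>z. 0 \<le> F z"
    and near: "\<And>V. open V \<Longrightarrow> 0 \<in> V \<Longrightarrow> \<exists>h\<in>V. ergodic_point m Gt act M F (act (- h) x)"
  shows "ergodic_point m Gt act M F x"
proof -
  let ?I = "\<lambda>z t. orbit_integral m act F (Gt t) z"
  note bounds = orbit_integral_near_bounds[OF qu F _ near]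
  have fin: "\<forall>\<^sub>F t in at_top. ?I x t \<noteq> \<infinity>"
  proof -
    obtain y where y: "ergodic_point m Gt act M F y"
      and xy: "\<forall>\<^sub>F t in at_top. ?I x t \<le> ?I y (t + 1) \<and> ?I y t \<le> ?I x (t + 1)"
      using bounds[of 1] by auto
    have "\<forall>\<^sub>F t in at_top. ?I y (t + 1) \<noteq> \<infinity>"
      using y unfolding ergodic_point_def by (auto dest: eventually_at_top_shift[where c = 1])
    with xy show ?thesis by eventually_elim (auto simp: top_unique)
  qed
  have "((\<lambda>t. enn2real (?I x t) / measure m (Gt t)) \<longlongrightarrow> (\<integral>z. F z \<partial>M)) at_top"
  proof (rule tendsto_ratio_sandwich)
    show "\<forall>\<^sub>F t in at_top. 0 < measure m (Gt t)"
      using eventually_gt_at_top[of 0] by eventually_elim (rule quasi_uniform_measure_pos[OF qu haar])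
    show "\<exists>\<epsilon>>0. \<forall>\<^sub>F t in at_top. measure m (Gt (t + \<epsilon>)) \<le> (1 + \<delta>) * measure m (Gt t)" if "0 < \<delta>" for \<delta>
      by (rule quasi_uniform_measure_growth[OF qu haar that])
  next
    fix \<epsilon> :: real assume "0 < \<epsilon>"
    then obtain y where y: "ergodic_point m Gt act M F y"
      and xy: "\<forall>\<^sub>F t in at_top. ?I x t \<le> ?I y (t + \<epsilon>) \<and> ?I y t \<le> ?I x (t + \<epsilon>)"
      using bounds by blast
    have fin_y: "\<forall>\<^sub>F t in at_top. ?I y t \<noteq> \<infinity>"
      and lim_y: "((\<lambda>t. haar_avg m (Gt t) act F y) \<longlongrightarrow> (\<integral>z. F z \<partial>M)) at_top"
      using y unfolding ergodic_point_def by blast+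
    have "((\<lambda>t. enn2real (?I y t) / measure m (Gt t)) \<longlongrightarrow> (\<integral>z. F z \<partial>M)) at_top"
      using tendsto_cong[OF haar_avg_eq_orbit_integral_eventually[OF qu F nonneg]] lim_y by simp
    moreover have "\<forall>\<^sub>F t in at_top. enn2real (?I x t) \<le> enn2real (?I y (t + \<epsilon>)) \<and>
                     enn2real (?I y t) \<le> enn2real (?I x (t + \<epsilon>))"
      using xy fin_y[THEN eventually_at_top_shift[where c = \<epsilon>]] fin[THEN eventually_at_top_shift[where c = \<epsilon>]]
      by eventually_elim (auto intro: enn2real_mono simp: less_top)
    ultimately show "\<exists>a. (\<forall>t. 0 \<le> a t) \<and> ((\<lambda>t. a t / measure m (Gt t)) \<longlongrightarrow> (\<integral>z. F z \<partial>M)) at_top \<and>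
        (\<forall>\<^sub>F t in at_top. enn2real (?I x t) \<le> a (t + \<epsilon>) \<and> a t \<le> enn2real (?I x (t + \<epsilon>)))"
      by (intro exI[of _ "\<lambda>t. enn2real (?I y t)"]) auto
  qed
  then have "((\<lambda>t. haar_avg m (Gt t) act F x) \<longlongrightarrow> (\<integral>z. F z \<partial>M)) at_top"
    using tendsto_cong[OF haar_avg_eq_orbit_integral_eventually[OF qu F nonneg]] by simp
  with fin show ?thesis
    unfolding ergodic_point_def by blast
qed

lemma AE_ergodic_point:
  assumes qu: "quasi_uniform m Gt" and pet: "pointwise_ergodic m Gt act M p"
    and F: "memLp M p F" and p: "1 \<le> p" and nonneg: "\<And>z. 0 \<le> F z"
  shows "AE x in M. ergodic_point m Gt act M F x"
proof -
  have Fm: "F \<in> borel_measurable M" using F by (simp add: memLp_def)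
  have "AE x in M. \<forall>n. orbit_integral m act F (Gt (Suc n)) x \<noteq> \<infinity>"
    unfolding AE_all_countable
    using quasi_uniform_emeasure_eq_measure[OF qu haar] quasi_uniform_sets[OF qu]
    by (intro allI AE_orbit_integral_finite[OF Fm memLp_integrable[OF F p] nonneg]) auto
  moreover have "AE x in M. ((\<lambda>t. haar_avg m (Gt t) act F x) \<longlongrightarrow> (\<integral>y. F y \<partial>M)) at_top"
    using pet F unfolding pointwise_ergodic_def by blast
  ultimately show ?thesis
  proof eventually_elim
    case (elim x)
    have "orbit_integral m act F (Gt t) x \<noteq> \<infinity>" if "1 \<le> t" for t
    proof -
      have "Gt t \<subseteq> Gt (Suc (nat \<lceil>t\<rceil>))"
        using that by (intro quasi_uniform_mono[OF qu]) linarith+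
      then have "orbit_integral m act F (Gt t) x \<le> orbit_integral m act F (Gt (Suc (nat \<lceil>t\<rceil>))) x"
        by (rule orbit_integral_mono)
      moreover have "orbit_integral m act F (Gt (Suc (nat \<lceil>t\<rceil>))) x \<noteq> \<infinity>"
        using elim by blast
      ultimately show ?thesis
        by (metis infinity_ennreal_def neq_top_trans)
    qed
    with elim show ?case
      unfolding ergodic_point_def eventually_at_top_linorder by blast
  qed
qed

lemma invariant_conull_set_of_ergodic_points:
  assumes qu: "quasi_uniform m Gt" and pet: "pointwise_ergodic m Gt act M p" and p: "1 \<le> p"
    and \<F>: "countable \<F>" "\<And>F. F \<in> \<F> \<Longrightarrow> memLp M p F" "\<And>F z. F \<in> \<F> \<Longrightarrow> 0 \<le> F z"
  shows "\<exists>\<Omega>\<in>sets M. emeasure M \<Omega> = 1 \<and> (\<forall>g x. act g x \<in> \<Omega> \<longleftrightarrow> x \<in> \<Omega>) \<and>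
           (\<forall>x\<in>\<Omega>. \<forall>F\<in>\<F>. ergodic_point m Gt act M F x)"
proof -
  have "AE x in M. \<forall>F\<in>\<F>. ergodic_point m Gt act M F x"
    using \<F> by (auto simp: AE_ball_countable intro!: AE_ergodic_point[OF qu pet _ p])
  from AE_imp_invariant_conull_set[OF this] obtain \<Omega> where
    \<Omega>: "\<Omega> \<in> sets M" "emeasure M \<Omega> = 1" "\<forall>g x. act g x \<in> \<Omega> \<longleftrightarrow> x \<in> \<Omega>" and
    near: "\<forall>x\<in>\<Omega>. \<forall>V. open V \<longrightarrow> 0 \<in> V \<longrightarrow> (\<exists>h\<in>V. \<forall>F\<in>\<F>. ergodic_point m Gt act M F (act (- h) x))"
    by (elim bexE conjE) (rule that)
  have "ergodic_point m Gt act M F x" if "x \<in> \<Omega>" "F \<in> \<F>" for x F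
  proof (rule ergodic_point_if_near[OF qu])
    show "F \<in> borel_measurable M" "\<And>z. 0 \<le> F z"
      using \<F>(2,3)[OF \<open>F \<in> \<F>\<close>] by (auto simp: memLp_def)
    show "\<exists>h\<in>V. ergodic_point m Gt act M F (act (- h) x)" if "open V" "0 \<in> V" for V
      using near \<open>x \<in> \<Omega>\<close> \<open>F \<in> \<F>\<close> that by fastforce
  qed
  with \<Omega> show ?thesis by (intro bexI[of _ \<Omega>]) auto
qed

lemma tendsto_haar_avg_diff:
  assumes qu: "quasi_uniform m Gt"
    and F: "F \<in> borel_measurable M" "integrable M F" "\<And>z. 0 \<le> F z" "ergodic_point m Gt act M F x"
    and G: "G \<in> borel_measurable M" "integrable M G" "\<And>z. 0 \<le> G z" "ergodic_point m Gt act M G x"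
  shows "((\<lambda>t. haar_avg m (Gt t) act (\<lambda>z. F z - G z) x) \<longlongrightarrow> (\<integral>z. F z - G z \<partial>M)) at_top"
proof -
  have "\<forall>\<^sub>F t in at_top. orbit_integral m act F (Gt t) x \<noteq> \<infinity>"
    and "\<forall>\<^sub>F t in at_top. orbit_integral m act G (Gt t) x \<noteq> \<infinity>"
    using F(4) G(4) unfolding ergodic_point_def by blast+
  then have "\<forall>\<^sub>F t in at_top.
          haar_avg m (Gt t) act F x - haar_avg m (Gt t) act G x = haar_avg m (Gt t) act (\<lambda>z. F z - G z) x"
    using eventually_gt_at_top[of 0]
  proof eventually_elim
    case (elim t)
    then show ?case
      using set_integrable_orbit[OF F(1,3) quasi_uniform_sets[OF qu]]
        set_integrable_orbit[OF G(1,3) quasi_uniform_sets[OF qu]]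
      by (simp add: haar_avg_def set_integral_diff right_diff_distrib)
  qed
  moreover have "((\<lambda>t. haar_avg m (Gt t) act F x - haar_avg m (Gt t) act G x)
      \<longlongrightarrow> (\<integral>z. F z \<partial>M) - (\<integral>z. G z \<partial>M)) at_top"
    using F(4) G(4) unfolding ergodic_point_def by (intro tendsto_diff) blast+
  ultimately show ?thesis
    using F(2) G(2) by (simp add: tendsto_cong)
qed

end

theorem theorem5p22:
  fixes m :: "('g::{topological_group_add, second_countable_topology, t2_space}) measure"
    and M :: "('x::polish_space) measure"
    and act :: "'g \<Rightarrow> 'x \<Rightarrow> 'x"
    and Gt :: "real \<Rightarrow> 'g set"
    and p :: ennreal
  assumes lc: "locally_compact_space (euclidean :: 'g topology)"
    and haar: "left_haar_measure m"
    and prob: "prob_space M"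
    and sets_M: "sets M = sets borel"
    and action: "mp_action act M"
    and p: "1 \<le> p"
    and qu: "quasi_uniform m Gt"
    and pet: "pointwise_ergodic m Gt act M p"
  shows "\<forall>f. memLp M p f \<longrightarrow>
           (\<exists>\<Omega> \<in> sets M. emeasure M \<Omega> = 1 \<and>
              (\<forall>g x. act g x \<in> \<Omega> \<longleftrightarrow> x \<in> \<Omega>) \<and>
              (\<forall>x \<in> \<Omega>. ((\<lambda>t. haar_avg m (Gt t) act f x) \<longlongrightarrow> (\<integral>y. f y \<partial>M)) at_top))"
proof (intro allI impI)
  interpret haar_action M m act
    by (rule haar_action.intro[OF prob haar_action_axioms.intro[OF lc haar _ action]])
      (simp add: sets_eq_imp_space_eq[OF sets_M])
  fix f assume f: "memLp M p f"
  define f\<^sub>p where "f\<^sub>p z = max (f z) 0" for z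
  define f\<^sub>n where "f\<^sub>n z = max (- f z) 0" for z
  have "f \<in> borel_measurable M"
    using f by (simp add: memLp_def)
  then have meas: "f\<^sub>p \<in> borel_measurable M" "f\<^sub>n \<in> borel_measurable M"
    unfolding f\<^sub>p_def f\<^sub>n_def by measurable
  have Lp: "memLp M p f\<^sub>p" "memLp M p f\<^sub>n"
    by (rule memLp_mono[OF f meas(1)], simp add: f\<^sub>p_def, rule memLp_mono[OF f meas(2)], simp add: f\<^sub>n_def)
  have nonneg: "\<And>z. 0 \<le> f\<^sub>p z" "\<And>z. 0 \<le> f\<^sub>n z" and f_eq: "f = (\<lambda>z. f\<^sub>p z - f\<^sub>n z)"
    by (auto simp: f\<^sub>p_def f\<^sub>n_def)
  obtain \<Omega> where \<Omega>: "\<Omega> \<in> sets M" "emeasure M \<Omega> = 1" "\<forall>g x. act g x \<in> \<Omega> \<longleftrightarrow> x \<in> \<Omega>"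
    and ergodic: "\<forall>x\<in>\<Omega>. \<forall>F\<in>{f\<^sub>p, f\<^sub>n}. ergodic_point m Gt act M F x"
    using invariant_conull_set_of_ergodic_points[OF qu pet p, of "{f\<^sub>p, f\<^sub>n}"] Lp nonneg
    by (auto elim!: bexE)
  have "((\<lambda>t. haar_avg m (Gt t) act f x) \<longlongrightarrow> (\<integral>y. f y \<partial>M)) at_top" if "x \<in> \<Omega>" for x
    unfolding f_eq using ergodic that memLp_integrable[OF Lp(1) p] memLp_integrable[OF Lp(2) p]
    by (intro tendsto_haar_avg_diff[OF qu] meas nonneg) auto
  with \<Omega> show "\<exists>\<Omega>\<in>sets M. emeasure M \<Omega> = 1 \<and> (\<forall>g x. act g x \<in> \<Omega> \<longleftrightarrow> x \<in> \<Omega>) \<and>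
      (\<forall>x\<in>\<Omega>. ((\<lambda>t. haar_avg m (Gt t) act f x) \<longlongrightarrow> (\<integral>y. f y \<partial>M)) at_top)"
    by (intro bexI[of _ \<Omega>] conjI ballI) auto
qed

end
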